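(* Let $R$ be a commutative ring. The Krull dimension of $R$ is $\le\ell$ if and only if the Krull dimension of its Zariski lattice $\mathrm{Zar}(R)$ is $\le\ell$.
   Context: Krull dimension of a ring: $R$ has dimension $\le-1$ iff $1=0$ in $R$; for $m\ge1$, $R$ has dimension $\le m-1$ iff for all $x_1,\ldots,x_m\in R$ there exist $a_1,\ldots,a_m\in R$ and $m_1,\ldots,m_m\in\mathbb{N}$ with $$x_1^{m_1}(x_2^{m_2}\cdots(x_m^{m_m}(1+a_mx_m)+\cdots+a_2x_2)+a_1x_1)=0.$$ Krull dimension of a distributive lattice $T$ (with $0,1$): $T$ has dimension $\le-1$ iff $1=0$ in $T$; for $m\ge1$, $T$ has dimension $\le m-1$ iff for all $x_1,\ldots,x_m\in T$ there exist $a_1,\ldots,a_m\in T$ such that $a_1\wedge x_1\le 0$, $a_{i+1}\wedge x_{i+1}\le a_i\vee x_i$ for $1\le i<m$, and $1\le a_m\vee x_m$. $\mathrm{Zar}(R)$ is the set of radicals of finitely generated ideals of $R$, ordered by inclusion; it is a distributive lattice with $\sqrt{I_1}\wedge\sqrt{I_2}=\sqrt{I_1I_2}$ and $\sqrt{I_1}\vee\sqrt{I_2}=\sqrt{I_1+I_2}$. *)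

theory Defs
  imports "HOL-Algebra.Ideal" "HOL-Algebra.Lattice"
begin

(* Both dimension predicates take the bound l as an integer, meant to range over l >= -1,
   and use m = l + 1 elements indexed by 1, ..., m. *)

(* The foldr term is
     x 1 ^ e 1 * (x 2 ^ e 2 * ( ... (x m ^ e m * (1 + a m * x m)) ... + a 2 * x 2) + a 1 * x 1),
   with the index 1 outermost. *)
definition ring_krull_dim_le :: "('a, 'b) ring_scheme \<Rightarrow> int \<Rightarrow> bool" where
  "ring_krull_dim_le R l \<longleftrightarrow>
     (if l = -1 then \<one>\<^bsub>R\<^esub> = \<zero>\<^bsub>R\<^esub>
      else (let m = nat (l + 1) in
        \<forall>x \<in> {1..m} \<rightarrow> carrier R. \<exists>a \<in> {1..m} \<rightarrow> carrier R. \<exists>e :: nat \<Rightarrow> nat.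
          foldr (\<lambda>i s. (x i [^]\<^bsub>R\<^esub> e i) \<otimes>\<^bsub>R\<^esub> (s \<oplus>\<^bsub>R\<^esub> (a i \<otimes>\<^bsub>R\<^esub> x i))) [1..<Suc m] \<one>\<^bsub>R\<^esub>
            = \<zero>\<^bsub>R\<^esub>))"

(* Intended for a bounded distributive lattice L, whose 0 and 1 are its bottom and top. *)
definition lattice_krull_dim_le :: "('a, 'b) gorder_scheme \<Rightarrow> int \<Rightarrow> bool" where
  "lattice_krull_dim_le L l \<longleftrightarrow>
     (if l = -1 then \<top>\<^bsub>L\<^esub> = \<bottom>\<^bsub>L\<^esub>
      else (let m = nat (l + 1) in
        \<forall>x \<in> {1..m} \<rightarrow> carrier L. \<exists>a \<in> {1..m} \<rightarrow> carrier L.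
          a 1 \<sqinter>\<^bsub>L\<^esub> x 1 \<sqsubseteq>\<^bsub>L\<^esub> \<bottom>\<^bsub>L\<^esub> \<and>
          (\<forall>i. 1 \<le> i \<and> i < m \<longrightarrow>
             a (i + 1) \<sqinter>\<^bsub>L\<^esub> x (i + 1) \<sqsubseteq>\<^bsub>L\<^esub> a i \<squnion>\<^bsub>L\<^esub> x i) \<and>
          \<top>\<^bsub>L\<^esub> \<sqsubseteq>\<^bsub>L\<^esub> a m \<squnion>\<^bsub>L\<^esub> x m))"

definition ideal_radical :: "('a, 'b) ring_scheme \<Rightarrow> 'a set \<Rightarrow> 'a set" where
  "ideal_radical R I = {x \<in> carrier R. \<exists>n :: nat. x [^]\<^bsub>R\<^esub> n \<in> I}"

(* The lattice operations are those induced by the inclusion order. The join of the radicals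
   of I and J is the radical of I + J, and their meet is the radical of I J. *)
definition Zar :: "('a, 'b) ring_scheme \<Rightarrow> 'a set gorder" where
  "Zar R = \<lparr>carrier = {ideal_radical R (genideal R S) | S. finite S \<and> S \<subseteq> carrier R},
            eq = (=), le = (\<subseteq>)\<rparr>"

end

(* For a radical ideal J and a set X, let B(J, X) be the radical of (J : X) + <X>. Both
   dimension conditions say that 1 lies in B(...B(B(sqrt 0, X_1), X_2)..., X_m): for the ring
   X_i ranges over singletons, for the lattice over radicals of finitely generated ideals.
   They agree because B(J, sqrt <S>) = B(J, S), because B(J, X) and B(J, Y) meet inside
   B(J, X Un Y), and because B(-, X) preserves intersections of radical ideals, so that
   singletons suffice by induction on the number of generators. *)

theory Submission
  imports Defs
begin

context cring
begin

subsection \<open>Radical ideals\<close>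

text \<open>Among radical ideals, \<open>colon J X\<close> is the Heyting implication from the
  radical ideal generated by X to J. So \<open>boundary J X\<close> is the largest value that a_i
  \<or> x_i can take, over all radical ideals a_i, once the previous stage is J, and iterating it
  eliminates the witnesses a_i. Two obstacles shape the way back to witnesses. On the lattice side,
  \<open>colon J X\<close> need not be the radical of a finitely generated ideal, so it cannot
  itself serve as a_i; but membership of \<open>\<one>\<close> in the last stage involves only
  finitely many elements of each colon ideal, and these generate suitable a_i, found from the last
  index backwards. On the ring side, the nested expression must be exactly \<open>\<zero>\<close>,
  not merely nilpotent, so radicals are too coarse there and saturations I : x^infinity take the
  place of colon ideals.\<close>

abbreviation rad :: "'a set \<Rightarrow> 'a set"
  where "rad \<equiv> ideal_radical R"

definition radical_ideal :: "'a set \<Rightarrow> bool"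
  where "radical_ideal J \<longleftrightarrow> ideal J R \<and> rad J = J"

lemma radical_ideal_imp_ideal: "radical_ideal J \<Longrightarrow> ideal J R"
  by (simp add: radical_ideal_def)

lemma ideal_subset_rad: "ideal I R \<Longrightarrow> I \<subseteq> rad I"
  using ideal.Icarr[of I R] by (force simp: ideal_radical_def intro!: exI[of _ "1::nat"])

lemma rad_mono: "I \<subseteq> J \<Longrightarrow> rad I \<subseteq> rad J"
  by (auto simp: ideal_radical_def)

lemma rad_subset_carrier: "rad I \<subseteq> carrier R"
  by (auto simp: ideal_radical_def)

lemma rad_rad: "rad (rad I) \<subseteq> rad I"
  by (auto simp: ideal_radical_def nat_pow_pow)

lemma one_in_radD: "\<one> \<in> rad I \<Longrightarrow> \<one> \<in> I"
  by (auto simp: ideal_radical_def)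

text \<open>This replaces the binomial expansion of (a + b)^(n + m). Splitting off one factor a + b
  gives two summands, in which the multiplier c absorbs an a or a b and so lowers n or m by one;
  that is why c is part of the statement and varies in the induction.\<close>

lemma mult_add_pow_in_ideal:
  fixes n m k :: nat
  assumes I: "ideal I R"
  shows "\<lbrakk>k = n + m; a \<in> carrier R; b \<in> carrier R; c \<in> carrier R;
    c \<otimes> a [^] n \<in> I; c \<otimes> b [^] m \<in> I\<rbrakk> \<Longrightarrow> c \<otimes> (a \<oplus> b) [^] k \<in> I"
proof (induction k arbitrary: n m c)
  case 0
  then show ?case by simp
next
  case (Suc k)
  interpret ideal I R by fact
  show ?case
  proof (cases "n = 0 \<or> m = 0")
    case True
    then have "c \<in> I" using Suc.prems by auto
    then show ?thesis using Suc.prems I_r_closed by simp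
  next
    case False
    then obtain n' m' where nm: "n = Suc n'" "m = Suc m'"
      by (metis not0_implies_Suc)
    have 1: "(c \<otimes> a) \<otimes> (a \<oplus> b) [^] k \<in> I"
    proof (rule Suc.IH[of n' m])
      show "c \<otimes> a \<otimes> a [^] n' \<in> I"
        using Suc.prems nm by (simp add: m_ac)
      have "a \<otimes> (c \<otimes> b [^] m) \<in> I"
        using Suc.prems I_l_closed by blast
      then show "c \<otimes> a \<otimes> b [^] m \<in> I"
        using Suc.prems by (simp add: m_ac)
    qed (use Suc.prems nm in auto)
    have 2: "(c \<otimes> b) \<otimes> (a \<oplus> b) [^] k \<in> I"
    proof (rule Suc.IH[of n m'])
      show "c \<otimes> b \<otimes> b [^] m' \<in> I"
        using Suc.prems nm by (simp add: m_ac)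
      have "b \<otimes> (c \<otimes> a [^] n) \<in> I"
        using Suc.prems I_l_closed by blast
      then show "c \<otimes> b \<otimes> a [^] n \<in> I"
        using Suc.prems by (simp add: m_ac)
    qed (use Suc.prems nm in auto)
    have "c \<otimes> (a \<oplus> b) [^] Suc k
        = (c \<otimes> a) \<otimes> (a \<oplus> b) [^] k \<oplus> (c \<otimes> b) \<otimes> (a \<oplus> b) [^] k"
      using Suc.prems(2-4) by (simp add: r_distr l_distr m_ac)
    then show ?thesis using 1 2 by (simp add: a_closed)
  qed
qed

lemma ideal_rad:
  assumes I: "ideal I R"
  shows "ideal (rad I) R"
proof -
  interpret ideal I R by fact
  show ?thesis
  proof (rule idealI[OF ring_axioms])
    show "subgroup (rad I) (add_monoid R)"
    proof (rule add.subgroupI)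
      show "rad I \<subseteq> carrier R" by (rule rad_subset_carrier)
      show "rad I \<noteq> {}" using ideal_subset_rad[OF I] additive_subgroup.zero_closed[OF is_additive_subgroup] by blast
    next
      fix a assume "a \<in> rad I"
      then obtain n :: nat where a: "a \<in> carrier R" "a [^] n \<in> I"
        by (auto simp: ideal_radical_def)
      have "(\<ominus> \<one>) [^] n \<otimes> a [^] n \<in> I" using a I_l_closed by simp
      then have "(\<ominus> a) [^] n \<in> I"
        using a by (simp add: nat_pow_distrib[symmetric] l_minus)
      then show "\<ominus> a \<in> rad I" using a by (auto simp: ideal_radical_def)
    next
      fix a b assume "a \<in> rad I" "b \<in> rad I"
      then obtain n m :: nat where "a \<in> carrier R" "a [^] n \<in> I" "b \<in> carrier R" "b [^] m \<in> I"
        by (auto simp: ideal_radical_def)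
      then show "a \<oplus> b \<in> rad I"
        using mult_add_pow_in_ideal[OF I refl, of a b \<one> n m] by (auto simp: ideal_radical_def)
    qed
  next
    fix a x assume "a \<in> rad I" and x: "x \<in> carrier R"
    then obtain n :: nat where a: "a \<in> carrier R" "a [^] n \<in> I"
      by (auto simp: ideal_radical_def)
    then have "(x \<otimes> a) [^] n \<in> I" using x I_l_closed by (simp add: nat_pow_distrib)
    then show xa: "x \<otimes> a \<in> rad I" using a x by (auto simp: ideal_radical_def)
    then show "a \<otimes> x \<in> rad I" using a x by (simp add: m_comm)
  qed
qed

lemma radical_ideal_rad: "ideal I R \<Longrightarrow> radical_ideal (rad I)"
  by (simp add: radical_ideal_def ideal_rad ideal_subset_rad rad_rad subset_antisym)

lemma radical_idealD:
  fixes n :: nat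
  shows "\<lbrakk>radical_ideal J; y \<in> carrier R; y [^] n \<in> J\<rbrakk> \<Longrightarrow> y \<in> J"
  by (auto simp: radical_ideal_def ideal_radical_def)

lemma radical_ideal_Int: "\<lbrakk>radical_ideal I; radical_ideal J\<rbrakk> \<Longrightarrow> radical_ideal (I \<inter> J)"
  using rad_mono[of "I \<inter> J" I] rad_mono[of "I \<inter> J" J] ideal_subset_rad[of "I \<inter> J"]
  by (auto simp: radical_ideal_def i_intersect)

text \<open>The universal property of the generated radical ideal, by which later inclusions are
  checked on generators alone.\<close>

lemma rad_Idl_subset_iff:
  assumes "radical_ideal U" "S \<subseteq> carrier R"
  shows "rad (Idl S) \<subseteq> U \<longleftrightarrow> S \<subseteq> U"
proof
  assume "rad (Idl S) \<subseteq> U"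
  then show "S \<subseteq> U"
    using genideal_self[OF assms(2)] ideal_subset_rad[OF genideal_ideal[OF assms(2)]] by blast
next
  assume "S \<subseteq> U"
  then have "Idl S \<subseteq> U"
    using assms genideal_minimal radical_ideal_def by blast
  then show "rad (Idl S) \<subseteq> U"
    using rad_mono assms radical_ideal_def by metis
qed

lemma radical_ideal_rad_Idl: "S \<subseteq> carrier R \<Longrightarrow> radical_ideal (rad (Idl S))"
  by (simp add: radical_ideal_rad genideal_ideal)

lemma subset_rad_Idl: "S \<subseteq> carrier R \<Longrightarrow> S \<subseteq> rad (Idl S)"
  using rad_Idl_subset_iff radical_ideal_rad_Idl by blast

subsection \<open>Boundary ideals\<close>

definition colon :: "'a set \<Rightarrow> 'a set \<Rightarrow> 'a set"
  where "colon J X = {y \<in> carrier R. \<forall>s\<in>X. y \<otimes> s \<in> J}"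

lemma ideal_colon:
  assumes J: "ideal J R" and X: "X \<subseteq> carrier R"
  shows "ideal (colon J X) R"
proof -
  interpret ideal J R by fact
  have X': "s \<in> X \<Longrightarrow> s \<in> carrier R" for s using X by auto
  show ?thesis
  proof (rule idealI[OF ring_axioms])
    show "subgroup (colon J X) (add_monoid R)"
    proof (rule add.subgroupI)
      have "\<zero> \<in> colon J X" using X' by (auto simp: colon_def zero_closed)
      then show "colon J X \<noteq> {}" by auto
    qed (auto simp: colon_def X' l_distr l_minus)
  next
    fix a x assume a: "a \<in> colon J X" and x: "x \<in> carrier R"
    then have "x \<otimes> a \<in> colon J X" using X' by (auto simp: colon_def m_assoc I_l_closed)
    then show "x \<otimes> a \<in> colon J X" "a \<otimes> x \<in> colon J X"
      using a x by (auto simp: m_comm colon_def)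
  qed
qed

text \<open>If y^n s lies in J, so does its multiple (y s)^(n+1), hence y s itself because J is
  radical.\<close>

lemma radical_ideal_colon:
  assumes J: "radical_ideal J" and X: "X \<subseteq> carrier R"
  shows "radical_ideal (colon J X)"
proof -
  interpret ideal J R using J by (rule radical_ideal_imp_ideal)
  have "y \<in> colon J X" if y: "y \<in> rad (colon J X)" for y
  proof -
    obtain n :: nat where n: "y \<in> carrier R" "y [^] n \<in> colon J X"
      using y by (auto simp: ideal_radical_def)
    have "y \<otimes> s \<in> J" if s: "s \<in> X" for s
    proof -
      have s': "s \<in> carrier R" using s X by auto
      have "y [^] n \<otimes> s \<in> J" using n s by (auto simp: colon_def)
      then have "(y [^] n \<otimes> s) \<otimes> s [^] n \<in> J"
        using s' I_r_closed nat_pow_closed by blast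
      then have "(y [^] n \<otimes> s [^] n) \<otimes> s \<in> J"
        using n s' by (simp add: m_ac)
      then have "(y \<otimes> s) [^] n \<otimes> s \<in> J" using n s' by (simp add: nat_pow_distrib)
      then have "((y \<otimes> s) [^] n \<otimes> s) \<otimes> y \<in> J"
        using n s' I_r_closed by blast
      then have "(y \<otimes> s) [^] Suc n \<in> J" using n s' by (simp add: m_ac)
      then show ?thesis using radical_idealD[OF J] n s' by blast
    qed
    then show ?thesis using n by (auto simp: colon_def)
  qed
  then show ?thesis
    using ideal_colon[OF radical_ideal_imp_ideal[OF J] X] ideal_subset_rad
    by (auto simp: radical_ideal_def)
qed

text \<open>By commutativity the relation \<open>A \<subseteq> colon U B\<close> is symmetric in A
  and B. Since colon ideals of U are radical, the left side can be closed up to a radical ideal;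
  swapping the sides closes up the other one too.\<close>

lemma subset_colon_rad_Idl:
  assumes U: "radical_ideal U" and S: "S \<subseteq> carrier R" and T: "T \<subseteq> carrier R"
    and ST: "S \<subseteq> colon U T"
  shows "rad (Idl S) \<subseteq> colon U (rad (Idl T))"
proof -
  have swap: "A \<subseteq> colon U B \<longleftrightarrow> B \<subseteq> colon U A"
    if "A \<subseteq> carrier R" "B \<subseteq> carrier R" for A B
    using that m_comm by (fastforce simp: colon_def subset_iff)
  have "rad (Idl S) \<subseteq> colon U T"
    using rad_Idl_subset_iff[OF radical_ideal_colon[OF U T] S] ST by blast
  then have "T \<subseteq> colon U (rad (Idl S))"
    using swap T rad_subset_carrier by blast
  then have "rad (Idl T) \<subseteq> colon U (rad (Idl S))"
    using rad_Idl_subset_iff[OF radical_ideal_colon[OF U rad_subset_carrier] T] by blast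
  then show ?thesis
    using swap rad_subset_carrier by blast
qed

lemma colon_rad_Idl:
  assumes U: "radical_ideal U" and T: "T \<subseteq> carrier R"
  shows "colon U (rad (Idl T)) = colon U T"
proof
  show "colon U (rad (Idl T)) \<subseteq> colon U T"
    using subset_rad_Idl[OF T] by (auto simp: colon_def)
  have c: "colon U T \<subseteq> carrier R" by (auto simp: colon_def)
  show "colon U T \<subseteq> colon U (rad (Idl T))"
    using subset_colon_rad_Idl[OF U c T] subset_rad_Idl[OF c] by blast
qed

text \<open>The Krull boundary ideal of X relative to J. X is an arbitrary set, so that singletons,
  finite sets of generators and members of \<open>Zar R\<close> are all treated by one
  operator.\<close>

definition boundary :: "'a set \<Rightarrow> 'a set \<Rightarrow> 'a set"
  where "boundary J X = rad (colon J X <+> Idl X)"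

lemma boundaryI:
  fixes n :: nat
  shows "\<lbrakk>y \<in> carrier R; y [^] n = b \<oplus> c; b \<in> colon J X; c \<in> Idl X\<rbrakk> \<Longrightarrow> y \<in> boundary J X"
  by (auto simp: boundary_def ideal_radical_def set_add_def')

lemma boundaryE:
  assumes "y \<in> boundary J X"
  obtains n :: nat and b c where "y \<in> carrier R" "y [^] n = b \<oplus> c" "b \<in> colon J X" "c \<in> Idl X"
  using assms by (auto simp: boundary_def ideal_radical_def set_add_def')

lemma radical_ideal_boundary:
  "\<lbrakk>radical_ideal J; X \<subseteq> carrier R\<rbrakk> \<Longrightarrow> radical_ideal (boundary J X)"
  by (simp add: boundary_def radical_ideal_rad add_ideals ideal_colon genideal_ideal
      radical_ideal_imp_ideal)

lemma subset_boundary: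
  assumes J: "radical_ideal J" and X: "X \<subseteq> carrier R"
  shows "X \<subseteq> boundary J X"
proof
  fix y assume "y \<in> X"
  moreover have "\<zero> \<in> colon J X"
    using ideal_colon[OF radical_ideal_imp_ideal[OF J] X]
    by (simp add: additive_subgroup.zero_closed ideal.axioms(1))
  ultimately show "y \<in> boundary J X"
    using X genideal_self[OF X] by (intro boundaryI[of y 1 \<zero> y]) auto
qed

lemma colon_subset_boundary:
  assumes J: "radical_ideal J" and X: "X \<subseteq> carrier R"
  shows "colon J X \<subseteq> boundary J X"
proof
  fix y assume "y \<in> colon J X"
  moreover have "\<zero> \<in> Idl X"
    using genideal_ideal[OF X] by (simp add: additive_subgroup.zero_closed ideal.axioms(1))
  ultimately show "y \<in> boundary J X"
    by (intro boundaryI[of y 1 y \<zero>]) (auto simp: colon_def)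
qed

lemma boundary_subset_iff:
  assumes J: "radical_ideal J" and X: "X \<subseteq> carrier R" and U: "radical_ideal U"
  shows "boundary J X \<subseteq> U \<longleftrightarrow> colon J X \<subseteq> U \<and> X \<subseteq> U"
proof
  assume "boundary J X \<subseteq> U"
  then show "colon J X \<subseteq> U \<and> X \<subseteq> U"
    using subset_boundary[OF J X] colon_subset_boundary[OF J X] by blast
next
  assume A: "colon J X \<subseteq> U \<and> X \<subseteq> U"
  interpret U: ideal U R using U by (rule radical_ideal_imp_ideal)
  have "Idl X \<subseteq> U" using A genideal_minimal[OF U.is_ideal] by blast
  then show "boundary J X \<subseteq> U"
    using A by (auto elim!: boundaryE)
      (metis U U.a_closed radical_idealD subsetD)
qed

text \<open>By \<open>boundary_subset_iff\<close> both sides are least radical ideals, over the same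
  colon ideal and over sets that generate the same radical ideal.\<close>

lemma boundary_rad_Idl:
  assumes J: "radical_ideal J" and S: "S \<subseteq> carrier R"
  shows "boundary J (rad (Idl S)) = boundary J S"
proof
  show "boundary J (rad (Idl S)) \<subseteq> boundary J S"
    using boundary_subset_iff[OF J rad_subset_carrier radical_ideal_boundary[OF J S]]
      rad_Idl_subset_iff[OF radical_ideal_boundary[OF J S] S]
      colon_rad_Idl[OF J S] subset_boundary[OF J S] colon_subset_boundary[OF J S]
    by simp
  have "radical_ideal (boundary J (rad (Idl S)))"
    by (rule radical_ideal_boundary[OF J rad_subset_carrier])
  then show "boundary J S \<subseteq> boundary J (rad (Idl S))"
    using boundary_subset_iff[OF J S, of "boundary J (rad (Idl S))"]
      subset_boundary[OF J rad_subset_carrier, of "Idl S"]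
      colon_subset_boundary[OF J rad_subset_carrier, of "Idl S"]
      colon_rad_Idl[OF J S] subset_rad_Idl[OF S]
    by blast
qed

lemma boundary_mono: "J \<subseteq> J' \<Longrightarrow> boundary J X \<subseteq> boundary J' X"
  unfolding boundary_def colon_def set_add_def' by (rule rad_mono) blast

text \<open>Common core of \<open>boundary_Int\<close> and \<open>boundary_Un\<close>. If powers of
  y are b + c and b' + c', their product is again a power of y, and in its expansion every term
  except b b' contains c or c' and so lies in \<open>Idl Z\<close>. Only b b' has to be checked,
  which is assumption \<open>c\<close>.\<close>

lemma boundary_Int_subset:
  assumes J: "radical_ideal J" and J': "radical_ideal J'"
    and X: "X \<subseteq> carrier R" and Y: "Y \<subseteq> carrier R" and Z: "Z \<subseteq> carrier R"
    and XZ: "X \<subseteq> Z" and YZ: "Y \<subseteq> Z"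
    and c: "\<And>b b'. \<lbrakk>b \<in> colon J X; b' \<in> colon J' Y\<rbrakk> \<Longrightarrow> b \<otimes> b' \<in> colon K Z"
  shows "boundary J X \<inter> boundary J' Y \<subseteq> boundary K Z"
proof
  fix y assume "y \<in> boundary J X \<inter> boundary J' Y"
  then obtain n n' :: nat and b b' c c' where y: "y \<in> carrier R"
    and e: "y [^] n = b \<oplus> c" "b \<in> colon J X" "c \<in> Idl X"
    and e': "y [^] n' = b' \<oplus> c'" "b' \<in> colon J' Y" "c' \<in> Idl Y"
    by (auto elim!: boundaryE)
  interpret Z: ideal "Idl Z" R using Z by (rule genideal_ideal)
  have cZ: "c \<in> Idl Z" "c' \<in> Idl Z"
    using e e' subset_Idl_subset[OF Z] XZ YZ by blast+
  then have cc: "c \<in> carrier R" "c' \<in> carrier R" by auto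
  have bc: "b \<in> carrier R" "b' \<in> carrier R" using e e' by (auto simp: colon_def)
  have "y [^] (n + n') = (b \<oplus> c) \<otimes> (b' \<oplus> c')"
    using y e e' by (simp add: nat_pow_mult[symmetric])
  also have "\<dots> = b \<otimes> b' \<oplus> (b \<otimes> c' \<oplus> c \<otimes> (b' \<oplus> c'))"
    using bc cc by (simp add: l_distr r_distr a_ac)
  finally show "y \<in> boundary K Z"
    using boundaryI[OF y _ c[OF e(2) e'(2)]] cZ bc cc Z.I_l_closed Z.I_r_closed Z.a_closed a_closed
    by metis
qed

lemma boundary_Int:
  assumes "radical_ideal J" "radical_ideal J'" "X \<subseteq> carrier R"
  shows "boundary J X \<inter> boundary J' X \<subseteq> boundary (J \<inter> J') X"
proof (rule boundary_Int_subset[OF assms assms(3,3) order.refl order.refl])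
  fix b b' assume "b \<in> colon J X" "b' \<in> colon J' X"
  moreover have "ideal (colon J X) R" "ideal (colon J' X) R"
    using assms ideal_colon radical_ideal_imp_ideal by auto
  ultimately have "b \<otimes> b' \<in> colon J X" "b \<otimes> b' \<in> colon J' X"
    by (simp_all add: ideal.Icarr ideal.I_l_closed ideal.I_r_closed)
  then show "b \<otimes> b' \<in> colon (J \<inter> J') X" by (auto simp: colon_def)
qed

lemma boundary_Un:
  assumes "radical_ideal J" "X \<subseteq> carrier R" "Y \<subseteq> carrier R"
  shows "boundary J X \<inter> boundary J Y \<subseteq> boundary J (X \<union> Y)"
proof (rule boundary_Int_subset[OF assms(1,1-3)])
  fix b b' assume "b \<in> colon J X" "b' \<in> colon J Y"
  moreover have "ideal (colon J X) R" "ideal (colon J Y) R"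
    using assms ideal_colon radical_ideal_imp_ideal by auto
  ultimately have "b \<otimes> b' \<in> colon J X" "b \<otimes> b' \<in> colon J Y"
    by (simp_all add: ideal.Icarr ideal.I_l_closed ideal.I_r_closed)
  then show "b \<otimes> b' \<in> colon J (X \<union> Y)" by (auto simp: colon_def)
qed (use assms in auto)

section \<open>Iterated boundaries\<close>

lemma radical_ideal_foldl_boundary:
  "\<lbrakk>radical_ideal J; \<forall>X\<in>set Xs. X \<subseteq> carrier R\<rbrakk> \<Longrightarrow> radical_ideal (foldl boundary J Xs)"
  by (induction Xs arbitrary: J) (simp_all add: radical_ideal_boundary)

lemma foldl_boundary_mono: "J \<subseteq> J' \<Longrightarrow> foldl boundary J Xs \<subseteq> foldl boundary J' Xs"
proof (induction Xs arbitrary: J J')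
  case (Cons X Xs)
  show ?case using Cons.IH[OF boundary_mono[OF Cons.prems]] by simp
qed simp

lemma foldl_boundary_increasing:
  "\<lbrakk>radical_ideal J; \<forall>X\<in>set Xs. X \<subseteq> carrier R\<rbrakk> \<Longrightarrow> J \<subseteq> foldl boundary J Xs"
proof (induction Xs arbitrary: J)
  case (Cons X Xs)
  interpret ideal J R using Cons.prems radical_ideal_imp_ideal by blast
  have "J \<subseteq> colon J X" using Cons.prems I_r_closed by (auto simp: colon_def subset_iff)
  also have "\<dots> \<subseteq> boundary J X" using Cons.prems colon_subset_boundary by simp
  also have "\<dots> \<subseteq> foldl boundary (boundary J X) Xs"
    using Cons.prems by (intro Cons.IH) (auto intro: radical_ideal_boundary)
  finally show ?case by simp
qed simp

text \<open>Carries an intersection formed at one stage through all the later stages, so that a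
  statement about the final stage can be split at an earlier one.\<close>

lemma foldl_boundary_Int:
  "\<lbrakk>radical_ideal J; radical_ideal J'; \<forall>X\<in>set Xs. X \<subseteq> carrier R\<rbrakk>
    \<Longrightarrow> foldl boundary J Xs \<inter> foldl boundary J' Xs \<subseteq> foldl boundary (J \<inter> J') Xs"
proof (induction Xs arbitrary: J J')
  case (Cons X Xs)
  have "foldl boundary (boundary J X) Xs \<inter> foldl boundary (boundary J' X) Xs
      \<subseteq> foldl boundary (boundary J X \<inter> boundary J' X) Xs"
    using Cons.prems by (intro Cons.IH) (auto intro: radical_ideal_boundary)
  also have "\<dots> \<subseteq> foldl boundary (boundary (J \<inter> J') X) Xs"
    using Cons.prems by (intro foldl_boundary_mono boundary_Int) auto
  finally show ?case by simp
qed simp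

lemma foldl_boundary_rad_Idl:
  "\<lbrakk>radical_ideal J; \<forall>S\<in>set Ss. S \<subseteq> carrier R\<rbrakk>
    \<Longrightarrow> foldl boundary J (map (\<lambda>S. rad (Idl S)) Ss) = foldl boundary J Ss"
  by (induction Ss arbitrary: J) (simp_all add: boundary_rad_Idl radical_ideal_boundary)

text \<open>Induction on the list with J arbitrary. Once the first set is a singleton
  \<open>{s}\<close>, the induction hypothesis at \<open>boundary J {s}\<close> takes care of all
  later sets. The first set is then assembled generator by generator, using
  \<open>boundary_Un\<close> at the first stage and \<open>foldl_boundary_Int\<close> for the
  others.\<close>

lemma foldl_boundary_singletons:
  assumes "radical_ideal J" "\<forall>S\<in>set Ss. finite S \<and> S \<subseteq> carrier R"
    and "\<And>xs. \<lbrakk>length xs = length Ss; set xs \<subseteq> carrier R\<rbrakk>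
      \<Longrightarrow> \<one> \<in> foldl boundary J (map (\<lambda>x. {x}) xs)"
  shows "\<one> \<in> foldl boundary J Ss"
  using assms
proof (induction Ss arbitrary: J)
  case Nil
  then show ?case by simp
next
  case (Cons S Ss)
  have Ss: "\<forall>X\<in>set Ss. X \<subseteq> carrier R" using Cons.prems by simp
  have single: "\<one> \<in> foldl boundary (boundary J {s}) Ss" if s: "s \<in> carrier R" for s
  proof (rule Cons.IH)
    fix xs assume "length xs = length Ss" "set xs \<subseteq> carrier R"
    then show "\<one> \<in> foldl boundary (boundary J {s}) (map (\<lambda>x. {x}) xs)"
      using s Cons.prems(3)[of "s # xs"] by simp
  qed (use Cons.prems s radical_ideal_boundary in auto)
  have "finite S" "S \<subseteq> carrier R" using Cons.prems by auto
  then have "\<one> \<in> foldl boundary (boundary J S) Ss"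
  proof (induction S rule: finite_induct)
    \<comment> \<open>With no generators the colon ideal is the whole ring, so \<open>\<one>\<close>
      is reached at once and later stages keep it.\<close>
    case empty
    have "\<one> \<in> boundary J {}"
      using colon_subset_boundary[OF Cons.prems(1), of "{}"] by (auto simp: colon_def)
    then show ?case
      using foldl_boundary_increasing[OF radical_ideal_boundary[OF Cons.prems(1)] Ss] by blast
  next
    case (insert s S)
    then have "\<one> \<in> foldl boundary (boundary J {s}) Ss \<inter> foldl boundary (boundary J S) Ss"
      using single by simp
    also have "\<dots> \<subseteq> foldl boundary (boundary J {s} \<inter> boundary J S) Ss"
      using insert.prems Cons.prems(1) Ss
      by (intro foldl_boundary_Int radical_ideal_boundary) auto
    also have "\<dots> \<subseteq> foldl boundary (boundary J ({s} \<union> S)) Ss"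
      using insert.prems Cons.prems(1) by (intro foldl_boundary_mono boundary_Un) auto
    finally show ?case by simp
  qed
  then show ?case by simp
qed

subsection \<open>Krull dimension of the ring\<close>

text \<open>The saturation I : x^infinity. It records what may stand behind a factor x^n in an
  element of I, with the exponent left open.\<close>

definition saturation :: "'a set \<Rightarrow> 'a \<Rightarrow> 'a set"
  where "saturation I x = {y \<in> carrier R. \<exists>n::nat. x [^] n \<otimes> y \<in> I}"

lemma ideal_saturation:
  assumes I: "ideal I R" and x: "x \<in> carrier R"
  shows "ideal (saturation I x) R"
proof -
  interpret ideal I R by fact
  show ?thesis
  proof (rule idealI[OF ring_axioms])
    show "subgroup (saturation I x) (add_monoid R)"
    proof (rule add.subgroupI)
      have "\<zero> \<in> saturation I x"
        using x additive_subgroup.zero_closed[OF is_additive_subgroup]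
        by (auto simp: saturation_def intro!: exI[of _ "0::nat"])
      then show "saturation I x \<noteq> {}" by auto
    next
      fix a b assume "a \<in> saturation I x" "b \<in> saturation I x"
      then obtain n m :: nat where a: "a \<in> carrier R" "x [^] n \<otimes> a \<in> I"
        and b: "b \<in> carrier R" "x [^] m \<otimes> b \<in> I"
        by (auto simp: saturation_def)
      have "x [^] (n + m) \<otimes> (a \<oplus> b) = x [^] m \<otimes> (x [^] n \<otimes> a) \<oplus> x [^] n \<otimes> (x [^] m \<otimes> b)"
        using a b x by (simp add: nat_pow_mult[symmetric] r_distr m_ac)
      also have "\<dots> \<in> I" using a b x I_l_closed by simp
      finally show "a \<oplus> b \<in> saturation I x" using a b by (auto simp: saturation_def)
    next
      fix a assume "a \<in> saturation I x"
      then show "\<ominus> a \<in> saturation I x"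
        using x by (auto simp: saturation_def r_minus)
    qed (auto simp: saturation_def)
  next
    fix a r assume "a \<in> saturation I x" and r: "r \<in> carrier R"
    then obtain n :: nat where a: "a \<in> carrier R" "x [^] n \<otimes> a \<in> I"
      by (auto simp: saturation_def)
    have "r \<otimes> (x [^] n \<otimes> a) \<in> I" using a r I_l_closed by simp
    then have "x [^] n \<otimes> (r \<otimes> a) \<in> I" using a r x by (simp add: m_ac)
    then show "r \<otimes> a \<in> saturation I x" using a r by (auto simp: saturation_def)
    then show "a \<otimes> r \<in> saturation I x" using a r by (simp add: m_comm)
  qed
qed

text \<open>From (y x)^n in I it follows that y^n lies in the saturation. This inclusion replaces a
  boundary of \<open>rad I\<close> by the radical of an ideal from whose elements exponents and
  coefficients can be read off.\<close>

lemma boundary_rad_subset: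
  assumes I: "ideal I R" and x: "x \<in> carrier R"
  shows "boundary (rad I) {x} \<subseteq> rad (saturation I x <+> Idl {x})"
proof -
  have X: "{x} \<subseteq> carrier R" using x by simp
  have id: "ideal (saturation I x <+> Idl {x}) R"
    by (simp add: I x add_ideals ideal_saturation genideal_ideal)
  have sum: "saturation I x \<union> Idl {x} \<subseteq> saturation I x <+> Idl {x}"
    using union_genideal[OF ideal_saturation[OF I x] genideal_ideal[OF X]]
      genideal_self[of "saturation I x \<union> Idl {x}"]
      ideal.Icarr[OF ideal_saturation[OF I x]] ideal.Icarr[OF genideal_ideal[OF X]]
    by auto
  have "colon (rad I) {x} \<subseteq> rad (saturation I x <+> Idl {x})"
  proof
    fix y assume "y \<in> colon (rad I) {x}"
    then obtain n :: nat where y: "y \<in> carrier R" "(y \<otimes> x) [^] n \<in> I"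
      by (auto simp: colon_def ideal_radical_def)
    then have "x [^] n \<otimes> y [^] n \<in> I" using x by (simp add: nat_pow_distrib m_comm)
    then have "y [^] n \<in> saturation I x" using y by (auto simp: saturation_def)
    then show "y \<in> rad (saturation I x <+> Idl {x})"
      using sum y by (auto simp: ideal_radical_def)
  qed
  moreover have "{x} \<subseteq> rad (saturation I x <+> Idl {x})"
    using sum genideal_self[OF X] ideal_subset_rad[OF id] by blast
  ultimately show ?thesis
    using boundary_subset_iff[OF radical_ideal_rad[OF I] X radical_ideal_rad[OF id]] by blast
qed

section \<open>The nested expression of the ring condition\<close>

abbreviation dim_step :: "(nat \<Rightarrow> 'a) \<Rightarrow> (nat \<Rightarrow> 'a) \<Rightarrow> (nat \<Rightarrow> nat) \<Rightarrow> nat \<Rightarrow> 'a \<Rightarrow> 'a"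
  where "dim_step x a e i s \<equiv> (x i [^] e i) \<otimes> (s \<oplus> (a i \<otimes> x i))"

lemma foldr_dim_step_closed:
  "\<lbrakk>x \<in> set is \<rightarrow> carrier R; a \<in> set is \<rightarrow> carrier R\<rbrakk>
    \<Longrightarrow> foldr (dim_step x a e) is \<one> \<in> carrier R"
  by (induction "is") (auto simp: Pi_iff)

text \<open>The outermost layer of the \<open>foldr\<close> has the same index as the first step of
  the \<open>foldl\<close>, so both are consumed together: if the whole expression lies in J, its
  inner part lies in \<open>boundary J {x i}\<close>.\<close>

lemma one_in_foldl_boundary_if_foldr:
  "\<lbrakk>radical_ideal J; x \<in> set is \<rightarrow> carrier R; a \<in> set is \<rightarrow> carrier R;
    foldr (dim_step x a e) is \<one> \<in> J\<rbrakk>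
    \<Longrightarrow> \<one> \<in> foldl boundary J (map (\<lambda>i. {x i}) is)"
proof (induction "is" arbitrary: J)
  case Nil
  then show ?case by simp
next
  case (Cons i "is")
  define s where "s = foldr (dim_step x a e) is \<one>"
  have c: "s \<in> carrier R" "x i \<in> carrier R" "a i \<in> carrier R"
    using Cons.prems foldr_dim_step_closed[of x "is" a e] by (auto simp: s_def)
  define t where "t = s \<oplus> a i \<otimes> x i"
  have t: "t \<in> carrier R" using c by (simp add: t_def)
  interpret J: ideal J R using Cons.prems radical_ideal_imp_ideal by blast
  have "x i [^] e i \<otimes> t \<in> J" using Cons.prems by (simp add: s_def t_def)
  \<comment> \<open>The extra factor completes the product to the power e i + 1 of t x_i, so that
    radicality of J removes the exponent.\<close>
  then have "(x i [^] e i \<otimes> t) \<otimes> (x i \<otimes> t [^] e i) \<in> J"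
    using c t J.I_r_closed by simp
  then have "(t \<otimes> x i) [^] Suc (e i) \<in> J"
    using c t by (simp add: nat_pow_distrib m_ac)
  then have "t \<otimes> x i \<in> J" using radical_idealD Cons.prems(1) c t by blast
  then have "t \<in> colon J {x i}" using t by (simp add: colon_def)
  then have tb: "t \<in> boundary J {x i}"
    using colon_subset_boundary[OF Cons.prems(1), of "{x i}"] c by auto
  have rb: "radical_ideal (boundary J {x i})"
    using radical_ideal_boundary Cons.prems(1) c by simp
  interpret B: ideal "boundary J {x i}" R using rb by (rule radical_ideal_imp_ideal)
  have "x i \<in> boundary J {x i}"
    using subset_boundary[OF Cons.prems(1), of "{x i}"] c by auto
  then have "t \<oplus> (\<ominus> a i) \<otimes> x i \<in> boundary J {x i}"
    using tb c B.I_l_closed by simp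
  moreover have "t \<oplus> (\<ominus> a i) \<otimes> x i = s"
    using c by (simp add: t_def l_minus a_assoc r_neg)
  ultimately have "foldr (dim_step x a e) is \<one> \<in> boundary J {x i}" by (simp add: s_def)
  then show ?case using Cons.IH[OF rb] Cons.prems by auto
qed

text \<open>The induction needs ideals that are not radical: the exponents \<open>e\<close> come from the saturation.\<close>

lemma foldr_if_one_in_foldl_boundary:
  "\<lbrakk>ideal I R; x \<in> set is \<rightarrow> carrier R; distinct is;
    \<one> \<in> foldl boundary (rad I) (map (\<lambda>i. {x i}) is)\<rbrakk>
    \<Longrightarrow> \<exists>a \<in> set is \<rightarrow> carrier R. \<exists>e. foldr (dim_step x a e) is \<one> \<in> I"
proof (induction "is" arbitrary: I)
  case Nil
  then show ?case by (simp add: one_in_radD)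
next
  case (Cons i "is")
  have xi: "x i \<in> carrier R" using Cons.prems by auto
  define I' :: "'a set" where "I' = saturation I (x i) <+> Idl {x i}"
  have I': "ideal I' R"
    unfolding I'_def by (simp add: Cons.prems(1) xi add_ideals ideal_saturation genideal_ideal)
  have "\<one> \<in> foldl boundary (rad I') (map (\<lambda>i. {x i}) is)"
    using foldl_boundary_mono[OF boundary_rad_subset[OF Cons.prems(1) xi]] Cons.prems(4)
    by (auto simp: I'_def)
  then obtain a e where a: "a \<in> set is \<rightarrow> carrier R"
    and *: "foldr (dim_step x a e) is \<one> \<in> I'"
    using Cons.IH[OF I'] Cons.prems by auto
  then obtain b c where bc: "foldr (dim_step x a e) is \<one> = b \<oplus> c"
    "b \<in> saturation I (x i)" "c \<in> Idl {x i}"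
    by (auto simp: I'_def set_add_def')
  obtain n :: nat where b: "b \<in> carrier R" "x i [^] n \<otimes> b \<in> I"
    using bc by (auto simp: saturation_def)
  obtain r where r: "r \<in> carrier R" "c = r \<otimes> x i"
    using bc(3) cgenideal_eq_genideal[OF xi] by (auto simp: cgenideal_def)
  \<comment> \<open>The inner expression is b + r x_i, so the coefficient -r cancels its second
    part, and n is the exponent that brings b into I. As \<open>is\<close> is distinct, these
    updates leave the inner layers unchanged.\<close>
  let ?a = "a(i := \<ominus> r)" and ?e = "e(i := n)"
  have eq: "foldr (dim_step x ?a ?e) is \<one> = foldr (dim_step x a e) is \<one>"
    using Cons.prems(3) by (intro foldr_cong) auto
  have "(b \<oplus> r \<otimes> x i) \<oplus> (\<ominus> r) \<otimes> x i = b"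
    using b r xi by (simp add: l_minus a_assoc r_neg)
  then have "foldr (dim_step x ?a ?e) (i # is) \<one> \<in> I"
    using eq bc b r by simp
  moreover have "?a \<in> set (i # is) \<rightarrow> carrier R" using a r by auto
  ultimately show ?case by blast
qed

text \<open>The two preceding lemmas at the zero ideal: the first starts from
  \<open>rad {\<zero>}\<close>, while the second ends in \<open>{\<zero>}\<close> itself and so
  yields an equation.\<close>

lemma ring_krull_dim_le_iff:
  assumes "0 \<le> l"
  shows "ring_krull_dim_le R l \<longleftrightarrow>
    (\<forall>x \<in> {1..nat (l + 1)} \<rightarrow> carrier R.
      \<one> \<in> foldl boundary (rad {\<zero>}) (map (\<lambda>i. {x i}) [1..<Suc (nat (l + 1))]))"
proof -
  define m where "m = nat (l + 1)"
  have set: "set [1..<Suc m] = {1..m}" by auto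
  have *: "(\<exists>a \<in> {1..m} \<rightarrow> carrier R. \<exists>e. foldr (dim_step x a e) [1..<Suc m] \<one> = \<zero>)
      \<longleftrightarrow> \<one> \<in> foldl boundary (rad {\<zero>}) (map (\<lambda>i. {x i}) [1..<Suc m])"
    if x: "x \<in> {1..m} \<rightarrow> carrier R" for x
  proof
    assume "\<exists>a \<in> {1..m} \<rightarrow> carrier R. \<exists>e. foldr (dim_step x a e) [1..<Suc m] \<one> = \<zero>"
    then obtain a e where a: "a \<in> {1..m} \<rightarrow> carrier R"
      and "foldr (dim_step x a e) [1..<Suc m] \<one> = \<zero>" by blast
    then have "foldr (dim_step x a e) [1..<Suc m] \<one> \<in> rad {\<zero>}"
      using ideal_subset_rad[OF zeroideal] by auto
    then show "\<one> \<in> foldl boundary (rad {\<zero>}) (map (\<lambda>i. {x i}) [1..<Suc m])"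
      using one_in_foldl_boundary_if_foldr[OF radical_ideal_rad[OF zeroideal],
          of x "[1..<Suc m]" a e, unfolded set, OF x a] by blast
  next
    assume "\<one> \<in> foldl boundary (rad {\<zero>}) (map (\<lambda>i. {x i}) [1..<Suc m])"
    then show "\<exists>a \<in> {1..m} \<rightarrow> carrier R. \<exists>e. foldr (dim_step x a e) [1..<Suc m] \<one> = \<zero>"
      using foldr_if_one_in_foldl_boundary[OF zeroideal, of x "[1..<Suc m]", unfolded set, OF x]
      by (simp only: distinct_upt singleton_iff simp_thms)
  qed
  have "ring_krull_dim_le R l \<longleftrightarrow> (\<forall>x \<in> {1..m} \<rightarrow> carrier R.
      \<exists>a \<in> {1..m} \<rightarrow> carrier R. \<exists>e. foldr (dim_step x a e) [1..<Suc m] \<one> = \<zero>)"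
    using assms by (simp add: ring_krull_dim_le_def m_def Let_def del: upt_Suc)
  then show ?thesis using * by (simp add: m_def del: upt_Suc cong: ball_cong)
qed

subsection \<open>Krull dimension of the Zariski lattice\<close>

lemma le_Zar [simp]: "U \<sqsubseteq>\<^bsub>Zar R\<^esub> V \<longleftrightarrow> U \<subseteq> V"
  by (simp add: Zar_def)

lemma mem_carrier_ZarE:
  assumes "U \<in> carrier (Zar R)"
  obtains S where "finite S" "S \<subseteq> carrier R" "U = rad (Idl S)"
  using assms by (auto simp: Zar_def)

lemma rad_Idl_mem_carrier_Zar:
  "\<lbrakk>finite S; S \<subseteq> carrier R\<rbrakk> \<Longrightarrow> rad (Idl S) \<in> carrier (Zar R)"
  by (auto simp: Zar_def)

lemma radical_ideal_Zar: "U \<in> carrier (Zar R) \<Longrightarrow> radical_ideal U"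
  by (auto elim!: mem_carrier_ZarE simp: radical_ideal_rad_Idl)

lemma Zar_subset_carrier: "U \<in> carrier (Zar R) \<Longrightarrow> U \<subseteq> carrier R"
  by (auto elim!: mem_carrier_ZarE simp: ideal_radical_def)

text \<open>Both sides are the least radical ideal containing S and T. This exhibits a finite
  generating set for a join.\<close>

lemma rad_Idl_Un_eq:
  assumes "S \<subseteq> carrier R" "T \<subseteq> carrier R"
  shows "rad (Idl (rad (Idl S) \<union> rad (Idl T))) = rad (Idl (S \<union> T))"
proof -
  have ST: "S \<union> T \<subseteq> carrier R" and
    rST: "rad (Idl S) \<union> rad (Idl T) \<subseteq> carrier R"
    using assms rad_subset_carrier by auto
  have "S \<union> T \<subseteq> rad (Idl (S \<union> T))" using subset_rad_Idl[OF ST] .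
  then have "rad (Idl S) \<subseteq> rad (Idl (S \<union> T))" "rad (Idl T) \<subseteq> rad (Idl (S \<union> T))"
    using rad_Idl_subset_iff[OF radical_ideal_rad_Idl[OF ST]] assms by auto
  then have "rad (Idl (rad (Idl S) \<union> rad (Idl T))) \<subseteq> rad (Idl (S \<union> T))"
    using rad_Idl_subset_iff[OF radical_ideal_rad_Idl[OF ST] rST] by auto
  moreover have "S \<union> T \<subseteq> rad (Idl (rad (Idl S) \<union> rad (Idl T)))"
    using subset_rad_Idl[OF rST] subset_rad_Idl assms by blast
  then have "rad (Idl (S \<union> T)) \<subseteq> rad (Idl (rad (Idl S) \<union> rad (Idl T)))"
    using rad_Idl_subset_iff[OF radical_ideal_rad_Idl[OF rST] ST] by blast
  ultimately show ?thesis by blast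
qed

lemma Un_closed_Zar:
  "\<lbrakk>U \<in> carrier (Zar R); V \<in> carrier (Zar R)\<rbrakk> \<Longrightarrow> rad (Idl (U \<union> V)) \<in> carrier (Zar R)"
  by (auto elim!: mem_carrier_ZarE simp: rad_Idl_Un_eq rad_Idl_mem_carrier_Zar)

text \<open>Translates the lattice inequalities into colon ideals: products of elements of U and V
  lie in the intersection, and conversely an element of the intersection has its square in
  W.\<close>

lemma Int_subset_iff_colon:
  assumes W: "radical_ideal W" and U: "ideal U R" and V: "ideal V R"
  shows "U \<inter> V \<subseteq> W \<longleftrightarrow> U \<subseteq> colon W V"
proof
  interpret U: ideal U R by fact
  interpret V: ideal V R by fact
  assume "U \<inter> V \<subseteq> W"
  then show "U \<subseteq> colon W V"
    using U.I_r_closed V.I_l_closed by (auto simp: colon_def)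
next
  interpret U: ideal U R by fact
  assume A: "U \<subseteq> colon W V"
  show "U \<inter> V \<subseteq> W"
  proof
    fix y assume y: "y \<in> U \<inter> V"
    then have "y \<in> carrier R" by auto
    moreover have "y \<otimes> y \<in> W" using A y by (auto simp: colon_def)
    ultimately show "y \<in> W"
      using radical_idealD[OF W, of y 2] by (simp add: numeral_2_eq_2)
  qed
qed

text \<open>The products of generators generate the meet up to radical. For the harder inclusion,
  \<open>S \<subseteq> colon (rad (Idl P)) T\<close> holds by the choice of P and extends from
  generators to U and V.\<close>

lemma Int_closed_Zar:
  assumes "U \<in> carrier (Zar R)" "V \<in> carrier (Zar R)"
  shows "U \<inter> V \<in> carrier (Zar R)"
proof -
  obtain S T where S: "finite S" "S \<subseteq> carrier R" "U = rad (Idl S)"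
    and T: "finite T" "T \<subseteq> carrier R" "V = rad (Idl T)"
    using assms by (metis mem_carrier_ZarE)
  define P where "P = (\<lambda>(s, t). s \<otimes> t) ` (S \<times> T)"
  have P: "finite P" "P \<subseteq> carrier R" using S T by (auto simp: P_def)
  have U: "radical_ideal U" and V: "radical_ideal V"
    using assms radical_ideal_Zar by auto
  interpret U: ideal U R using U by (rule radical_ideal_imp_ideal)
  interpret V: ideal V R using V by (rule radical_ideal_imp_ideal)
  have "S \<subseteq> U" "T \<subseteq> V" using S T subset_rad_Idl by auto
  then have "P \<subseteq> U \<inter> V"
    using S T U.I_r_closed V.I_l_closed by (auto simp: P_def subset_iff)
  then have "rad (Idl P) \<subseteq> U \<inter> V"
    using rad_Idl_subset_iff[OF radical_ideal_Int[OF U V] P(2)] by blast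
  moreover have "S \<subseteq> colon (rad (Idl P)) T"
    using subset_rad_Idl[OF P(2)] S(2) by (auto simp: colon_def P_def)
  then have "U \<subseteq> colon (rad (Idl P)) V"
    using subset_colon_rad_Idl[OF radical_ideal_rad_Idl[OF P(2)] S(2) T(2)] S T by simp
  then have "U \<inter> V \<subseteq> rad (Idl P)"
    using Int_subset_iff_colon[OF radical_ideal_rad_Idl[OF P(2)] U.is_ideal V.is_ideal] by simp
  ultimately have "U \<inter> V = rad (Idl P)" by blast
  then show ?thesis using rad_Idl_mem_carrier_Zar[OF P] by simp
qed

lemma least_Zar_iff:
  "least (Zar R) U A \<longleftrightarrow> A \<subseteq> carrier (Zar R) \<and> U \<in> A \<and> (\<forall>V\<in>A. U \<subseteq> V)"
  by (simp add: least_def)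

lemma greatest_Zar_iff:
  "greatest (Zar R) U A \<longleftrightarrow> A \<subseteq> carrier (Zar R) \<and> U \<in> A \<and> (\<forall>V\<in>A. V \<subseteq> U)"
  by (simp add: greatest_def)

text \<open>\<open>Zar R\<close> carries only an order, and HOL-Algebra selects joins, meets and
  bounds by Hilbert choice. Identifying them therefore takes both existence and uniqueness, here and
  in the next three lemmas.\<close>

lemma join_Zar:
  assumes "U \<in> carrier (Zar R)" "V \<in> carrier (Zar R)"
  shows "U \<squnion>\<^bsub>Zar R\<^esub> V = rad (Idl (U \<union> V))"
  unfolding join_def sup_def
proof (rule some_equality)
  have UV: "U \<union> V \<subseteq> carrier R" using assms Zar_subset_carrier by auto
  show *: "least (Zar R) (rad (Idl (U \<union> V))) (Upper (Zar R) {U, V})"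
    using assms Un_closed_Zar subset_rad_Idl[OF UV] rad_Idl_subset_iff[OF radical_ideal_Zar UV]
    by (auto simp: least_Zar_iff Upper_def)
  show "W = rad (Idl (U \<union> V))" if "least (Zar R) W (Upper (Zar R) {U, V})" for W
    using that * by (simp add: least_Zar_iff subset_antisym)
qed

lemma meet_Zar:
  assumes "U \<in> carrier (Zar R)" "V \<in> carrier (Zar R)"
  shows "U \<sqinter>\<^bsub>Zar R\<^esub> V = U \<inter> V"
  unfolding meet_def inf_def
proof (rule some_equality)
  show *: "greatest (Zar R) (U \<inter> V) (Lower (Zar R) {U, V})"
    using assms Int_closed_Zar by (auto simp: greatest_Zar_iff Lower_def)
  show "W = U \<inter> V" if "greatest (Zar R) W (Lower (Zar R) {U, V})" for W
    using that * by (simp add: greatest_Zar_iff subset_antisym)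
qed

lemma top_Zar: "\<top>\<^bsub>Zar R\<^esub> = carrier R"
  unfolding top_def
proof (rule some_equality)
  have "rad (carrier R) = carrier R"
    using ideal_subset_rad[OF oneideal] rad_subset_carrier by blast
  then show *: "greatest (Zar R) (carrier R) (carrier (Zar R))"
    using rad_Idl_mem_carrier_Zar[of "{\<one>}"] Zar_subset_carrier
    by (simp add: greatest_Zar_iff genideal_one)
  show "W = carrier R" if "greatest (Zar R) W (carrier (Zar R))" for W
    using that * by (simp add: greatest_Zar_iff subset_antisym)
qed

lemma bottom_Zar: "\<bottom>\<^bsub>Zar R\<^esub> = rad {\<zero>}"
  unfolding bottom_def
proof (rule some_equality)
  have "rad {\<zero>} \<subseteq> U" if "U \<in> carrier (Zar R)" for U
    using rad_Idl_subset_iff[OF radical_ideal_Zar[OF that], of "{\<zero>}"]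
      radical_ideal_imp_ideal[OF radical_ideal_Zar[OF that]]
    by (simp add: genideal_zero additive_subgroup.zero_closed ideal.axioms(1))
  then show *: "least (Zar R) (rad {\<zero>}) (carrier (Zar R))"
    using rad_Idl_mem_carrier_Zar[of "{\<zero>}"] by (simp add: least_Zar_iff genideal_zero)
  show "W = rad {\<zero>}" if "least (Zar R) W (carrier (Zar R))" for W
    using that * by (simp add: least_Zar_iff subset_antisym)
qed

text \<open>These are the elements \<open>a\<^sub>i \<or> x\<^sub>i\<close> of the lattice condition, with \<open>0\<close> at index \<open>0\<close> so that
  the first inequality takes the same shape as the others.\<close>

definition Zar_chain :: "(nat \<Rightarrow> 'a set) \<Rightarrow> (nat \<Rightarrow> 'a set) \<Rightarrow> nat \<Rightarrow> 'a set"
  where "Zar_chain x a i = (if i = 0 then rad {\<zero>} else rad (Idl (a i \<union> x i)))"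

lemma radical_ideal_Zar_chain:
  assumes "x \<in> {1..m} \<rightarrow> carrier (Zar R)" "a \<in> {1..m} \<rightarrow> carrier (Zar R)" "i \<le> m"
  shows "radical_ideal (Zar_chain x a i)"
proof (cases "i = 0")
  case True
  then show ?thesis by (simp add: Zar_chain_def radical_ideal_rad zeroideal)
next
  case False
  then have "a i \<in> carrier (Zar R)" "x i \<in> carrier (Zar R)" using assms by auto
  then have "a i \<union> x i \<subseteq> carrier R" using Zar_subset_carrier by simp
  then show ?thesis using False by (simp add: Zar_chain_def radical_ideal_rad_Idl)
qed

text \<open>Iterated boundaries dominate every admissible chain: the inequality at each index puts a
  into the colon ideal of the preceding stage.\<close>

lemma Zar_chain_subset_foldl_boundary:
  assumes x: "x \<in> {1..m} \<rightarrow> carrier (Zar R)" and a: "a \<in> {1..m} \<rightarrow> carrier (Zar R)"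
    and step: "\<And>i. i < m \<Longrightarrow> a (Suc i) \<inter> x (Suc i) \<subseteq> Zar_chain x a i"
  shows "k \<le> m \<Longrightarrow> Zar_chain x a k \<subseteq> foldl boundary (rad {\<zero>}) (map x [1..<Suc k])"
proof (induction k)
  case 0
  then show ?case by (simp add: Zar_chain_def)
next
  case (Suc k)
  define J where "J = foldl boundary (rad {\<zero>}) (map x [1..<Suc k])"
  have J: "radical_ideal J"
    unfolding J_def
    using x Zar_subset_carrier Suc.prems
    by (intro radical_ideal_foldl_boundary radical_ideal_rad zeroideal) (fastforce simp: Pi_iff)
  have ax: "a (Suc k) \<in> carrier (Zar R)" "x (Suc k) \<in> carrier (Zar R)"
    using x a Suc.prems by auto
  then have sub: "a (Suc k) \<subseteq> carrier R" "x (Suc k) \<subseteq> carrier R"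
    using Zar_subset_carrier by auto
  have "a (Suc k) \<inter> x (Suc k) \<subseteq> J"
    using Suc step[of k] by (auto simp: J_def)
  then have "a (Suc k) \<subseteq> colon J (x (Suc k))"
    using Int_subset_iff_colon[OF J] ax radical_ideal_Zar radical_ideal_imp_ideal by blast
  then have "a (Suc k) \<union> x (Suc k) \<subseteq> boundary J (x (Suc k))"
    using subset_boundary[OF J sub(2)] colon_subset_boundary[OF J sub(2)] by blast
  then have "rad (Idl (a (Suc k) \<union> x (Suc k))) \<subseteq> boundary J (x (Suc k))"
    using rad_Idl_subset_iff[OF radical_ideal_boundary[OF J sub(2)]] sub by simp
  then show ?case by (simp add: Zar_chain_def J_def)
qed

text \<open>A compactness argument: a finite part F of a stage is already reached by finitely
  generated a_i. F is arbitrary in the induction because the last index only passes a new finite set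
  of demands on to the stage before it.\<close>

lemma ex_Zar_chain:
  assumes x: "x \<in> {1..m} \<rightarrow> carrier (Zar R)"
  shows "\<lbrakk>k \<le> m; finite F; F \<subseteq> foldl boundary (rad {\<zero>}) (map x [1..<Suc k])\<rbrakk>
    \<Longrightarrow> \<exists>a. (\<forall>i. a i \<in> carrier (Zar R)) \<and>
      (\<forall>i<k. a (Suc i) \<inter> x (Suc i) \<subseteq> Zar_chain x a i) \<and> F \<subseteq> Zar_chain x a k"
proof (induction k arbitrary: F)
  case 0
  have "rad (Idl {}) \<in> carrier (Zar R)" by (rule rad_Idl_mem_carrier_Zar) auto
  then show ?case using 0 by (auto simp: Zar_chain_def intro!: exI[of _ "\<lambda>_. rad (Idl {})"])
next
  case (Suc k)
  define J where "J = foldl boundary (rad {\<zero>}) (map x [1..<Suc k])"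
  have "x (Suc k) \<in> carrier (Zar R)" using x Suc.prems by auto
  then obtain S where S: "finite S" "S \<subseteq> carrier R" "x (Suc k) = rad (Idl S)"
    by (rule mem_carrier_ZarE)
  have "F \<subseteq> boundary J (x (Suc k))" using Suc.prems by (simp add: J_def)
  \<comment> \<open>Only the colon parts b enter the new witness, so b alone is chosen as a function
    of f; n and c stay existential.\<close>
  then have "\<forall>f\<in>F. \<exists>b. b \<in> colon J (x (Suc k)) \<and>
      (\<exists>(n::nat) c. f \<in> carrier R \<and> f [^] n = b \<oplus> c \<and> c \<in> Idl (x (Suc k)))"
    by (blast elim: boundaryE)
  from bchoice[OF this] obtain b where b: "\<forall>f\<in>F. b f \<in> colon J (x (Suc k)) \<and>
      (\<exists>(n::nat) c. f \<in> carrier R \<and> f [^] n = b f \<oplus> c \<and> c \<in> Idl (x (Suc k)))" ..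
  define G where "G = b ` F"
  have G: "finite G" "G \<subseteq> carrier R" "G \<subseteq> colon J (x (Suc k))"
    using Suc.prems(2) b by (auto simp: G_def colon_def)
  \<comment> \<open>These products are the demands on the previous stage: once the chain contains P
    at k, the ideal generated by G is admissible as the next a, whereas G itself was only known to
    multiply x into the larger ideal J.\<close>
  define P where "P = (\<lambda>(g, s). g \<otimes> s) ` (G \<times> S)"
  have xS: "S \<subseteq> x (Suc k)" using S subset_rad_Idl by simp
  have "finite P" "P \<subseteq> J" using G S(1) xS by (auto simp: P_def colon_def)
  then obtain a where a: "\<forall>i. a i \<in> carrier (Zar R)"
    "\<forall>i<k. a (Suc i) \<inter> x (Suc i) \<subseteq> Zar_chain x a i" "P \<subseteq> Zar_chain x a k"
    using Suc.IH[OF Suc_leD[OF Suc.prems(1)], of P] unfolding J_def by blast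
  define a' where "a' = a(Suc k := rad (Idl G))"
  have a': "\<forall>i. a' i \<in> carrier (Zar R)"
    using a G by (simp add: a'_def rad_Idl_mem_carrier_Zar)
  \<comment> \<open>Stages up to k do not see the updated index Suc k, so the earlier inequalities
    survive.\<close>
  have chain: "Zar_chain x a' i = Zar_chain x a i" if "i \<le> k" for i
    using that by (simp add: Zar_chain_def a'_def)
  have rk: "radical_ideal (Zar_chain x a k)"
    by (rule radical_ideal_Zar_chain[OF x]) (use a(1) Suc.prems(1) in auto)
  have "G \<subseteq> colon (Zar_chain x a k) S"
    using a(3) G(2) by (auto simp: colon_def P_def)
  then have "rad (Idl G) \<subseteq> colon (Zar_chain x a k) (x (Suc k))"
    using subset_colon_rad_Idl[OF rk G(2) S(2)] S(3) by simp
  then have "rad (Idl G) \<inter> x (Suc k) \<subseteq> Zar_chain x a k"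
    using Int_subset_iff_colon[OF rk ideal_rad[OF genideal_ideal[OF G(2)]]
        ideal_rad[OF genideal_ideal[OF S(2)]]] S(3) by simp
  then have "\<forall>i<Suc k. a' (Suc i) \<inter> x (Suc i) \<subseteq> Zar_chain x a' i"
    using a(2) chain by (auto simp: less_Suc_eq a'_def)
  moreover have "F \<subseteq> Zar_chain x a' (Suc k)"
  proof
    fix f assume f: "f \<in> F"
    obtain n :: nat and c where c: "f \<in> carrier R" "f [^] n = b f \<oplus> c" "c \<in> Idl (x (Suc k))"
      using bspec[OF b f] by blast
    have xs: "x (Suc k) \<subseteq> carrier R" using S(3) rad_subset_carrier by simp
    have un: "a' (Suc k) \<union> x (Suc k) \<subseteq> carrier R"
      using a' Zar_subset_carrier xs by blast
    interpret I: ideal "Idl (a' (Suc k) \<union> x (Suc k))" R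
      by (rule genideal_ideal[OF un])
    have "b f \<in> a' (Suc k)" using subset_rad_Idl[OF G(2)] f by (auto simp: a'_def G_def)
    then have "b f \<in> Idl (a' (Suc k) \<union> x (Suc k))" using genideal_self[OF un] by blast
    moreover have "c \<in> Idl (a' (Suc k) \<union> x (Suc k))"
      using c(3) subset_Idl_subset[OF un, of "x (Suc k)"] by blast
    ultimately have "f [^] n \<in> Idl (a' (Suc k) \<union> x (Suc k))" using c(2) I.a_closed by simp
    then show "f \<in> Zar_chain x a' (Suc k)"
      using c(1) by (auto simp: Zar_chain_def ideal_radical_def)
  qed
  ultimately show ?case using a' by blast
qed

lemma lattice_krull_dim_le_Zar_iff:
  assumes "0 \<le> l"
  shows "lattice_krull_dim_le (Zar R) l \<longleftrightarrow>
    (\<forall>x \<in> {1..nat (l + 1)} \<rightarrow> carrier (Zar R).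
      \<one> \<in> foldl boundary (rad {\<zero>}) (map x [1..<Suc (nat (l + 1))]))"
proof -
  define m where "m = nat (l + 1)"
  have m: "1 \<le> m" using assms by (simp add: m_def)
  let ?cond = "\<lambda>x a. a 1 \<sqinter>\<^bsub>Zar R\<^esub> x 1 \<sqsubseteq>\<^bsub>Zar R\<^esub> \<bottom>\<^bsub>Zar R\<^esub> \<and>
          (\<forall>i. 1 \<le> i \<and> i < m \<longrightarrow>
             a (i + 1) \<sqinter>\<^bsub>Zar R\<^esub> x (i + 1) \<sqsubseteq>\<^bsub>Zar R\<^esub> a i \<squnion>\<^bsub>Zar R\<^esub> x i) \<and>
          \<top>\<^bsub>Zar R\<^esub> \<sqsubseteq>\<^bsub>Zar R\<^esub> a m \<squnion>\<^bsub>Zar R\<^esub> x m"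
  have cond: "?cond x a \<longleftrightarrow> (\<forall>i<m. a (Suc i) \<inter> x (Suc i) \<subseteq> Zar_chain x a i) \<and>
      \<one> \<in> Zar_chain x a m"
    if x: "x \<in> {1..m} \<rightarrow> carrier (Zar R)" and a: "a \<in> {1..m} \<rightarrow> carrier (Zar R)" for x a
  proof -
    have mem: "x i \<in> carrier (Zar R)" "a i \<in> carrier (Zar R)" if "1 \<le> i" "i \<le> m" for i
      using x a that by auto
    have join: "a i \<squnion>\<^bsub>Zar R\<^esub> x i = Zar_chain x a i" if "1 \<le> i" "i \<le> m" for i
      using that mem[OF that] by (simp add: join_Zar Zar_chain_def)
    have meet: "a (Suc i) \<sqinter>\<^bsub>Zar R\<^esub> x (Suc i) = a (Suc i) \<inter> x (Suc i)" if "i < m" for i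
      using that mem[of "Suc i"] by (simp add: meet_Zar)
    have "ideal (Zar_chain x a m) R"
      using radical_ideal_Zar_chain[OF x a] radical_ideal_imp_ideal by blast
    then have top: "carrier R \<subseteq> Zar_chain x a m \<longleftrightarrow> \<one> \<in> Zar_chain x a m"
      using ideal.one_imp_carrier by blast
    \<comment> \<open>Index 0 gives the inequality a_1 \<and> x_1 \<le> 0, which the lattice
      condition states separately; m is at least 1, so this index occurs.\<close>
    have split: "(\<forall>i<m. Q i) \<longleftrightarrow> Q 0 \<and> (\<forall>i. 1 \<le> i \<and> i < m \<longrightarrow> Q i)" for Q
      using m by (metis One_nat_def Suc_leI less_one neq0_conv not_less order_less_le_trans)
    show ?thesis
      unfolding split le_Zar bottom_Zar top_Zar using m meet join top
      by (simp add: Zar_chain_def)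
  qed
  have "(\<exists>a \<in> {1..m} \<rightarrow> carrier (Zar R). ?cond x a) \<longleftrightarrow>
      \<one> \<in> foldl boundary (rad {\<zero>}) (map x [1..<Suc m])"
    if x: "x \<in> {1..m} \<rightarrow> carrier (Zar R)" for x
  proof
    assume "\<exists>a \<in> {1..m} \<rightarrow> carrier (Zar R). ?cond x a"
    then obtain a where a: "a \<in> {1..m} \<rightarrow> carrier (Zar R)" "?cond x a" by blast
    then show "\<one> \<in> foldl boundary (rad {\<zero>}) (map x [1..<Suc m])"
      using Zar_chain_subset_foldl_boundary[OF x a(1) _ order.refl] cond[OF x a(1)] by blast
  next
    assume "\<one> \<in> foldl boundary (rad {\<zero>}) (map x [1..<Suc m])"
    \<comment> \<open>The demand at the last stage is the single element \<open>\<one>\<close>,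
      hence F = \<open>{\<one>}\<close>.\<close>
    then obtain a where a: "\<forall>i. a i \<in> carrier (Zar R)"
      "\<forall>i<m. a (Suc i) \<inter> x (Suc i) \<subseteq> Zar_chain x a i" "\<one> \<in> Zar_chain x a m"
      using ex_Zar_chain[OF x order.refl, of "{\<one>}"] by blast
    then have "a \<in> {1..m} \<rightarrow> carrier (Zar R)" by auto
    then show "\<exists>a \<in> {1..m} \<rightarrow> carrier (Zar R). ?cond x a"
      using cond[OF x] a by blast
  qed
  moreover have "lattice_krull_dim_le (Zar R) l \<longleftrightarrow>
      (\<forall>x \<in> {1..m} \<rightarrow> carrier (Zar R). \<exists>a \<in> {1..m} \<rightarrow> carrier (Zar R). ?cond x a)"
    using assms unfolding lattice_krull_dim_le_def Let_def m_def by simp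
  ultimately show ?thesis unfolding m_def by blast
qed

text \<open>From ring to lattice, each x_i is replaced by a finite generating set, to which the
  reduction to singletons applies. From lattice to ring, the lattice condition is specialised to
  radicals of principal ideals.\<close>

lemma foldl_boundary_singletons_iff_Zar:
  "(\<forall>x \<in> {1..m} \<rightarrow> carrier R.
      \<one> \<in> foldl boundary (rad {\<zero>}) (map (\<lambda>i. {x i}) [1..<Suc m])) \<longleftrightarrow>
    (\<forall>x \<in> {1..m} \<rightarrow> carrier (Zar R).
      \<one> \<in> foldl boundary (rad {\<zero>}) (map x [1..<Suc m]))"
  (is "?ring \<longleftrightarrow> ?lattice")
proof -
  have r0: "radical_ideal (rad {\<zero>})" by (rule radical_ideal_rad[OF zeroideal])
  have set: "set [1..<Suc m] = {1..m}" by auto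
  show ?thesis
  proof
    assume ?ring
    show ?lattice
    proof
      fix x assume x: "x \<in> {1..m} \<rightarrow> carrier (Zar R)"
      then have "\<forall>i\<in>{1..m}. \<exists>S. finite S \<and> S \<subseteq> carrier R \<and> x i = rad (Idl S)"
        by (metis PiE mem_carrier_ZarE)
      then obtain S where S: "\<forall>i\<in>{1..m}. finite (S i) \<and> S i \<subseteq> carrier R \<and> x i = rad (Idl (S i))"
        by metis
      have "\<one> \<in> foldl boundary (rad {\<zero>}) (map S [1..<Suc m])"
      proof (rule foldl_boundary_singletons[OF r0])
        show "\<forall>X\<in>set (map S [1..<Suc m]). finite X \<and> X \<subseteq> carrier R"
          using S unfolding set_map set by blast
      next
        fix ys assume ys: "length ys = length (map S [1..<Suc m])" "set ys \<subseteq> carrier R"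
        then have len: "length ys = m" by simp
        \<comment> \<open>List positions start at 0, the family at 1.\<close>
        define y where "y i = ys ! (i - 1)" for i
        have "map (\<lambda>y. {y}) ys = map (\<lambda>i. {y i}) [1..<Suc m]"
          using len by (intro nth_equalityI) (simp_all add: y_def del: upt_Suc)
        moreover have "y \<in> {1..m} \<rightarrow> carrier R"
          using ys len by (auto simp: y_def subset_iff)
        ultimately show "\<one> \<in> foldl boundary (rad {\<zero>}) (map (\<lambda>x. {x}) ys)"
          using \<open>?ring\<close> by simp
      qed
      moreover have "map x [1..<Suc m] = map (\<lambda>S. rad (Idl S)) (map S [1..<Suc m])"
        unfolding map_map by (rule map_cong[OF refl]) (use S set in auto)
      moreover have "\<forall>X\<in>set (map S [1..<Suc m]). X \<subseteq> carrier R"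
        using S unfolding set_map set by blast
      ultimately show "\<one> \<in> foldl boundary (rad {\<zero>}) (map x [1..<Suc m])"
        using foldl_boundary_rad_Idl[OF r0, of "map S [1..<Suc m]"] by (simp only:)
    qed
  next
    assume ?lattice
    show ?ring
    proof
      fix x assume x: "x \<in> {1..m} \<rightarrow> carrier R"
      then have "(\<lambda>i. rad (Idl {x i})) \<in> {1..m} \<rightarrow> carrier (Zar R)"
        by (auto intro!: rad_Idl_mem_carrier_Zar)
      then have "\<one> \<in> foldl boundary (rad {\<zero>}) (map (\<lambda>i. rad (Idl {x i})) [1..<Suc m])"
        using \<open>?lattice\<close> by blast
      moreover have "\<forall>X\<in>set (map (\<lambda>i. {x i}) [1..<Suc m]). X \<subseteq> carrier R"
        using x unfolding set_map set by auto
      ultimately show "\<one> \<in> foldl boundary (rad {\<zero>}) (map (\<lambda>i. {x i}) [1..<Suc m])"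
        using foldl_boundary_rad_Idl[OF r0, of "map (\<lambda>i. {x i}) [1..<Suc m]"]
        by (simp add: comp_def del: upt_Suc)
    qed
  qed
qed

lemma top_Zar_eq_bottom_iff: "\<top>\<^bsub>Zar R\<^esub> = \<bottom>\<^bsub>Zar R\<^esub> \<longleftrightarrow> \<one> = \<zero>"
proof
  assume "\<top>\<^bsub>Zar R\<^esub> = \<bottom>\<^bsub>Zar R\<^esub>"
  then have "\<one> \<in> rad {\<zero>}" by (metis top_Zar bottom_Zar one_closed)
  then show "\<one> = \<zero>" using one_in_radD by blast
next
  assume "\<one> = \<zero>"
  then have "carrier R = {\<zero>}" using carrier_one_zero by simp
  then show "\<top>\<^bsub>Zar R\<^esub> = \<bottom>\<^bsub>Zar R\<^esub>"
    using ideal_subset_rad[OF zeroideal] rad_subset_carrier[of "{\<zero>}"]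
    by (auto simp: top_Zar bottom_Zar)
qed

end

theorem corollary3p5:
  fixes R :: "('a, 'b) ring_scheme" and l :: int
  assumes "cring R" and "-1 \<le> l"
  shows "ring_krull_dim_le R l \<longleftrightarrow> lattice_krull_dim_le (Zar R) l"
proof -
  interpret cring R by fact
  show ?thesis
  proof (cases "l = -1")
    case True
    then show ?thesis
      by (simp add: ring_krull_dim_le_def lattice_krull_dim_le_def top_Zar_eq_bottom_iff)
  next
    case False
    then have "0 \<le> l" using assms(2) by simp
    then show ?thesis
      using ring_krull_dim_le_iff lattice_krull_dim_le_Zar_iff foldl_boundary_singletons_iff_Zar
      by blast
  qed
qed

end
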